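(* Let $D$ be an integral domain with quotient field $K$, and let $\mathcal{S}$ be a multiplicative set of nonzero ideals of $D$. Then the map $A \mapsto A_{\mathcal{S}}$ ($A \in F(D)$) is a star-operation if and only if the saturation $\bar{\mathcal{S}}$ of $\mathcal{S}$ is a localizing GV-system, i.e. $\bar{\mathcal{S}}$ is a localizing system and $\bar{\mathcal{S}} \subseteq \mathcal{S}_v$.
   Context: $K^\ast = K\setminus\{0\}$. A fractional ideal of $D$ is a $D$-submodule $A$ of $K$ with $xA \subseteq D$ for some nonzero $x \in D$. $F(D)$ is the set of nonzero fractional ideals of $D$ and $I(D)$ the set of nonzero (integral) ideals of $D$. A star-operation on $F(D)$ is a map $\star: F(D) \to F(D)$, $A \mapsto A^\star$, such that for all $A,B \in F(D)$ and $a \in K^\ast$: (1) $(a)^\star = (a)$ and $(aA)^\star = aA^\star$; (2) $A \subseteq A^\star$, and $A \subseteq B$ implies $A^\star \subseteq B^\star$; (3) $(A^\star)^\star = A^\star$. A multiplicative set of ideals of $D$ is a nonempty set $\mathcal{S}$ of ideals of $D$ such that $I,J\in\mathcal{S}$ implies $IJ \in \mathcal{S}$. For a $D$-submodule $A$ of $K$, $A_{\mathcal{S}} = \{x \in K \mid xI \subseteq A \text{ for some } I \in \mathcal{S}\}$. The saturation of $\mathcal{S}$ is $\bar{\mathcal{S}} = \{A \text{ an ideal of } D \mid I \subseteq A \subseteq D \text{ for some } I \in \mathcal{S}\}$; it is again a multiplicative set of ideals. For $A\in F(D)$, $A^{-1} = \{x \in K \mid xA \subseteq D\}$ and $A_v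 = (A^{-1})^{-1}$. $\mathcal{S}_v = \{I \in I(D) \mid I_v = D\}$ (equivalently, $I^{-1}=D$). A GV-system is a multiplicative set of ideals contained in $\mathcal{S}_v$. A nonempty set $\mathcal{F}$ of ideals of $D$ is a localizing system if (1) $I \in \mathcal{F}$ and $J$ an ideal with $I \subseteq J \subseteq D$ imply $J \in \mathcal{F}$, and (2) $I \in \mathcal{F}$ and $J$ an ideal of $D$ with $(J:i) \in \mathcal{F}$ for all $i \in I$ imply $J \in \mathcal{F}$, where $(J:i) = \{x \in D \mid xi \in J\}$. *)

theory Defs
  imports "HOL-Algebra.Algebra"
begin

text \<open>
  As usual, an integral domain \<open>D\<close> is regarded as a subring of its quotient field \<open>K\<close>.
  The ring \<open>D\<close> itself is the record \<open>K\<lparr>carrier := D\<rparr>\<close>.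
\<close>

locale quotient_field = field K + D: subdomain D K for D and K (structure) +
  assumes fraction: "x \<in> carrier K \<Longrightarrow> \<exists>a\<in>D. \<exists>b\<in>D - {\<zero>}. x = a \<otimes> inv b"

abbreviation ideal_of :: "'a set \<Rightarrow> ('a, 'b) ring_scheme \<Rightarrow> 'a set \<Rightarrow> bool" where
  "ideal_of D K I \<equiv> ideal I (K\<lparr>carrier := D\<rparr>)"

definition self_module :: "('a, 'b) ring_scheme \<Rightarrow> ('a, 'a) module" where
  "self_module K =
     \<lparr>carrier = carrier K, monoid.mult = (\<otimes>\<^bsub>K\<^esub>), one = \<one>\<^bsub>K\<^esub>,
      ring.zero = \<zero>\<^bsub>K\<^esub>, add = (\<oplus>\<^bsub>K\<^esub>),
      module.smult = (\<otimes>\<^bsub>K\<^esub>)\<rparr>"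

lemma (in quotient_field) module_self_module:
  "module (K\<lparr>carrier := D\<rparr>) (self_module K)"
proof (rule moduleI)
  have "subcring D K"
    using D.subdomain_axioms unfolding subdomain_def by blast
  then show "cring (K\<lparr>carrier := D\<rparr>)"
    using subcring_iff subcringE(1) by blast
  show "abelian_group (self_module K)"
    by (rule abelian_groupI) (auto simp: self_module_def a_ac intro: a_closed
        bexI[of _ "\<ominus> x" for x] l_neg)
qed (use D.subset in \<open>auto simp: self_module_def l_distr r_distr m_assoc subset_iff\<close>)

text \<open>\<open>a <#\<^bsub>K\<^esub> A\<close> is the multiple \<open>aA\<close>; in particular \<open>a <#\<^bsub>K\<^esub> D\<close> is the principal
  fractional ideal \<open>(a)\<close>.\<close>

definition fractional_ideal :: "'a set \<Rightarrow> ('a, 'b) ring_scheme \<Rightarrow> 'a set \<Rightarrow> bool" where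
  "fractional_ideal D K A \<longleftrightarrow>
     submodule A (K\<lparr>carrier := D\<rparr>) (self_module K) \<and>
     (\<exists>x\<in>D - {\<zero>\<^bsub>K\<^esub>}. x <#\<^bsub>K\<^esub> A \<subseteq> D)"

definition nonzero_fractional_ideals :: "'a set \<Rightarrow> ('a, 'b) ring_scheme \<Rightarrow> 'a set set" where
  "nonzero_fractional_ideals D K = {A. fractional_ideal D K A \<and> A \<noteq> {\<zero>\<^bsub>K\<^esub>}}"

definition nonzero_ideals :: "'a set \<Rightarrow> ('a, 'b) ring_scheme \<Rightarrow> 'a set set" where
  "nonzero_ideals D K = {I. ideal_of D K I \<and> I \<noteq> {\<zero>\<^bsub>K\<^esub>}}"

definition star_operation ::
    "'a set \<Rightarrow> ('a, 'b) ring_scheme \<Rightarrow> ('a set \<Rightarrow> 'a set) \<Rightarrow> bool" where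
  "star_operation D K star \<longleftrightarrow>
     (let F = nonzero_fractional_ideals D K in
       star \<in> F \<rightarrow> F \<and>
       (\<forall>a\<in>carrier K - {\<zero>\<^bsub>K\<^esub>}. star (a <#\<^bsub>K\<^esub> D) = a <#\<^bsub>K\<^esub> D) \<and>
       (\<forall>a\<in>carrier K - {\<zero>\<^bsub>K\<^esub>}. \<forall>A\<in>F. star (a <#\<^bsub>K\<^esub> A) = a <#\<^bsub>K\<^esub> star A) \<and>
       (\<forall>A\<in>F. A \<subseteq> star A) \<and>
       (\<forall>A\<in>F. \<forall>B\<in>F. A \<subseteq> B \<longrightarrow> star A \<subseteq> star B) \<and>
       (\<forall>A\<in>F. star (star A) = star A))"

definition multiplicative_set_of_ideals ::
    "'a set \<Rightarrow> ('a, 'b) ring_scheme \<Rightarrow> 'a set set \<Rightarrow> bool" where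
  "multiplicative_set_of_ideals D K S \<longleftrightarrow>
     S \<noteq> {} \<and> (\<forall>I\<in>S. ideal_of D K I) \<and>
     (\<forall>I\<in>S. \<forall>J\<in>S. ideal_prod (K\<lparr>carrier := D\<rparr>) I J \<in> S)"

text \<open>The module \<open>A\<^sub>S\<close>.\<close>

definition ideal_transform :: "('a, 'b) ring_scheme \<Rightarrow> 'a set set \<Rightarrow> 'a set \<Rightarrow> 'a set" where
  "ideal_transform K S A = {x \<in> carrier K. \<exists>I\<in>S. x <#\<^bsub>K\<^esub> I \<subseteq> A}"

definition saturation :: "'a set \<Rightarrow> ('a, 'b) ring_scheme \<Rightarrow> 'a set set \<Rightarrow> 'a set set" where
  "saturation D K S = {A. ideal_of D K A \<and> (\<exists>I\<in>S. I \<subseteq> A)}"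

definition fractional_inverse :: "'a set \<Rightarrow> ('a, 'b) ring_scheme \<Rightarrow> 'a set \<Rightarrow> 'a set" where
  "fractional_inverse D K A = {x \<in> carrier K. x <#\<^bsub>K\<^esub> A \<subseteq> D}"

definition v_closure :: "'a set \<Rightarrow> ('a, 'b) ring_scheme \<Rightarrow> 'a set \<Rightarrow> 'a set" where
  "v_closure D K A = fractional_inverse D K (fractional_inverse D K A)"

text \<open>The set \<open>S\<^sub>v\<close>.\<close>

definition v_dense_ideals :: "'a set \<Rightarrow> ('a, 'b) ring_scheme \<Rightarrow> 'a set set" where
  "v_dense_ideals D K = {I \<in> nonzero_ideals D K. v_closure D K I = D}"

definition GV_system :: "'a set \<Rightarrow> ('a, 'b) ring_scheme \<Rightarrow> 'a set set \<Rightarrow> bool" where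
  "GV_system D K S \<longleftrightarrow> multiplicative_set_of_ideals D K S \<and> S \<subseteq> v_dense_ideals D K"

definition ideal_colon :: "'a set \<Rightarrow> ('a, 'b) ring_scheme \<Rightarrow> 'a set \<Rightarrow> 'a \<Rightarrow> 'a set" where
  "ideal_colon D K J i = {x \<in> D. x \<otimes>\<^bsub>K\<^esub> i \<in> J}"

definition localizing_system :: "'a set \<Rightarrow> ('a, 'b) ring_scheme \<Rightarrow> 'a set set \<Rightarrow> bool" where
  "localizing_system D K F \<longleftrightarrow>
     F \<noteq> {} \<and> (\<forall>I\<in>F. ideal_of D K I) \<and>
     (\<forall>I\<in>F. \<forall>J. ideal_of D K J \<and> I \<subseteq> J \<longrightarrow> J \<in> F) \<and>
     (\<forall>I\<in>F. \<forall>J. ideal_of D K J \<and> (\<forall>i\<in>I. ideal_colon D K J i \<in> F) \<longrightarrow> J \<in> F)"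

end

theory Submission
  imports Defs
begin

text \<open>
  Two of the axioms of a star-operation carry the information. The identity \<open>D\<^sub>S = D\<close> says exactly
  that every ideal of the saturation has inverse \<open>D\<close>, hence \<open>v\<close>-closure \<open>D\<close>. Idempotence
  \<open>(A\<^sub>S)\<^sub>S = A\<^sub>S\<close> is the second axiom of a localizing system: if \<open>(J : i)\<close> lies in the saturation
  for all \<open>i \<in> I\<close>, then \<open>I \<subseteq> J\<^sub>S\<close>, so \<open>1 \<in> (J\<^sub>S)\<^sub>S\<close>; conversely, if \<open>xI \<subseteq> A\<^sub>S\<close>, apply the axiom
  to \<open>J = {d \<in> D. xd \<in> A}\<close>.
\<close>

section \<open>Elementwise forms and monotonicity of multiples, ideal products and
  transforms\<close>

lemma l_coset_subset_iff: "x <#\<^bsub>G\<^esub> H \<subseteq> A \<longleftrightarrow> (\<forall>h\<in>H. x \<otimes>\<^bsub>G\<^esub> h \<in> A)"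
  by (auto simp: l_coset_def)

lemma mem_l_coset_iff: "y \<in> x <#\<^bsub>G\<^esub> H \<longleftrightarrow> (\<exists>h\<in>H. y = x \<otimes>\<^bsub>G\<^esub> h)"
  by (auto simp: l_coset_def)

lemma ideal_prod_mono:
  assumes "I \<subseteq> I'" "J \<subseteq> J'"
  shows "ideal_prod R I J \<subseteq> ideal_prod R I' J'"
proof
  fix x assume "x \<in> ideal_prod R I J"
  then show "x \<in> ideal_prod R I' J'"
    using assms by (induction rule: ideal_prod.induct) (auto intro: ideal_prod.intros)
qed

lemma mem_ideal_transform_iff:
  "x \<in> ideal_transform K S A \<longleftrightarrow> x \<in> carrier K \<and> (\<exists>I\<in>S. \<forall>i\<in>I. x \<otimes>\<^bsub>K\<^esub> i \<in> A)"
  by (simp add: ideal_transform_def l_coset_subset_iff)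

lemma ideal_transform_mono: "A \<subseteq> B \<Longrightarrow> ideal_transform K S A \<subseteq> ideal_transform K S B"
  by (auto simp: ideal_transform_def)

section \<open>Submodules of \<open>K\<close> and ideals of \<open>D\<close>\<close>

context quotient_field
begin

lemma ring_D: "ring (K\<lparr>carrier := D\<rparr>)"
  by (rule subring_is_ring) (rule D.subring_axioms)

lemma D_closed [simp]:
  "d \<in> D \<Longrightarrow> d \<in> carrier K"
  "\<zero> \<in> D" "\<one> \<in> D"
  "d \<in> D \<Longrightarrow> e \<in> D \<Longrightarrow> d \<oplus> e \<in> D"
  "d \<in> D \<Longrightarrow> e \<in> D \<Longrightarrow> d \<otimes> e \<in> D"
  "d \<in> D \<Longrightarrow> \<ominus> d \<in> D"
  using subdomainE[OF D.subdomain_axioms] by auto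

abbreviation D_submodule :: "'a set \<Rightarrow> bool" where
  "D_submodule A \<equiv> submodule A (K\<lparr>carrier := D\<rparr>) (self_module K)"

text \<open>The two additive monoids agree in carrier, operation and unit, hence also in inverses.
  This makes the additive group lemmas of \<open>K\<close> available for submodules of
  \<open>self_module K\<close>.\<close>

lemma subgroup_add_self_module_iff:
  "subgroup A (add_monoid (self_module K)) \<longleftrightarrow> subgroup A (add_monoid K)"
  by (simp add: subgroup_def m_inv_def self_module_def)

text \<open>Closure under negation follows from closure under scalars, because
  \<open>\<ominus> a = \<ominus> \<one> \<otimes> a\<close> and \<open>\<ominus> \<one>\<close> lies
  in \<open>D\<close>.\<close>

lemma D_submodule_iff:
  "D_submodule A \<longleftrightarrow>
     A \<subseteq> carrier K \<and> \<zero> \<in> A \<and> (\<forall>x\<in>A. \<forall>y\<in>A. x \<oplus> y \<in> A) \<and> (\<forall>d\<in>D. \<forall>x\<in>A. d \<otimes> x \<in> A)"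
    (is "_ \<longleftrightarrow> ?R")
proof -
  have "subgroup A (add_monoid K)" if R: ?R
  proof (rule add.subgroupI)
    fix a assume "a \<in> A"
    with R have "\<ominus> \<one> \<otimes> a \<in> A" "a \<in> carrier K"
      by auto
    then show "\<ominus> a \<in> A"
      by (simp add: l_minus)
  qed (use R in auto)
  then show ?thesis
    unfolding submodule_def submodule_axioms_def subgroup_add_self_module_iff
    by (auto simp: self_module_def dest: add.subgroupE subgroup.one_closed subgroup.subset
        subgroup.m_closed)
qed

text \<open>Commutativity of \<open>K\<close> turns closure under left scalars into two-sided
  absorption. Integral and fractional ideals can thus be handled by the same submodule
  criterion.\<close>

lemma ideal_of_iff: "ideal_of D K I \<longleftrightarrow> D_submodule I \<and> I \<subseteq> D"
proof
  assume I: "ideal_of D K I"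
  show "D_submodule I \<and> I \<subseteq> D"
    using ideal.I_l_closed[OF I] additive_subgroup.a_subset[OF ideal.axioms(1)[OF I]]
      additive_subgroup.zero_closed[OF ideal.axioms(1)[OF I]]
      additive_subgroup.a_closed[OF ideal.axioms(1)[OF I]]
    by (auto simp: D_submodule_iff)
next
  assume I: "D_submodule I \<and> I \<subseteq> D"
  have "subgroup I (add_monoid K)"
    using I by (simp add: submodule_def subgroup_add_self_module_iff)
  then have "subgroup I (add_monoid K\<lparr>carrier := D\<rparr>)"
    using I D.subgroup_axioms add.subgroup_incl by blast
  moreover have "x \<otimes> a \<in> I" "a \<otimes> x \<in> I" if "a \<in> I" "x \<in> D" for a x
    using I that m_comm[of a x] by (auto simp: D_submodule_iff)
  ultimately show "ideal_of D K I"
    by (intro idealI ring_D) simp_all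
qed

lemma ideal_of_D: "ideal_of D K D"
  by (auto simp: ideal_of_iff D_submodule_iff)

lemma ideal_of_ideal_prod:
  assumes "ideal_of D K I" "ideal_of D K J"
  shows "ideal_of D K (ideal_prod (K\<lparr>carrier := D\<rparr>) I J)"
    and "ideal_prod (K\<lparr>carrier := D\<rparr>) I J \<subseteq> I"
    and "ideal_prod (K\<lparr>carrier := D\<rparr>) I J \<subseteq> J"
  using ring.ideal_prod_is_ideal[OF ring_D assms] ring.ideal_prod_inter[OF ring_D assms] by auto

lemma nonzero_ideal_is_fractional:
  assumes "ideal_of D K J" "J \<noteq> {\<zero>}"
  shows "J \<in> nonzero_fractional_ideals D K"
proof -
  have "\<one> <#\<^bsub>K\<^esub> J \<subseteq> D"
    unfolding l_coset_subset_iff using assms(1) by (auto simp: ideal_of_iff subset_iff)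
  then show ?thesis
    using assms by (auto simp: nonzero_fractional_ideals_def fractional_ideal_def ideal_of_iff
        intro!: bexI[of _ \<one>])
qed

text \<open>This set is the preimage of \<open>A\<close> under the \<open>D\<close>-linear map
  \<open>d \<mapsto> x \<otimes> d\<close>. It supplies the ideal, and its colon ideals, to which
  the second axiom of a localizing system is applied.\<close>

lemma preimage_mult_ideal:
  assumes "D_submodule A" "x \<in> carrier K"
  shows "ideal_of D K {d \<in> D. x \<otimes> d \<in> A}"
  using assms unfolding ideal_of_iff D_submodule_iff
  by (auto simp: r_distr m_lcomm)

section \<open>The transform of a submodule: module structure, extension, homogeneity\<close>

lemma D_submodule_ideal_transform:
  assumes S: "multiplicative_set_of_ideals D K S" and A: "D_submodule A"
  shows "D_submodule (ideal_transform K S A)"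
  unfolding D_submodule_iff
proof (intro conjI ballI)
  have S_ideal: "I \<subseteq> D" if "I \<in> S" for I
    using S that by (auto simp: multiplicative_set_of_ideals_def ideal_of_iff)
  show "ideal_transform K S A \<subseteq> carrier K"
    by (auto simp: mem_ideal_transform_iff)
  obtain I where "I \<in> S"
    using S by (auto simp: multiplicative_set_of_ideals_def)
  then show "\<zero> \<in> ideal_transform K S A"
    using A S_ideal by (auto simp: mem_ideal_transform_iff D_submodule_iff subset_iff intro!: bexI[of _ I])
  show "x \<oplus> y \<in> ideal_transform K S A"
    if xy: "x \<in> ideal_transform K S A" "y \<in> ideal_transform K S A" for x y
  proof -
    obtain I J where IJ: "I \<in> S" "J \<in> S" "\<forall>i\<in>I. x \<otimes> i \<in> A" "\<forall>j\<in>J. y \<otimes> j \<in> A"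
      and K: "x \<in> carrier K" "y \<in> carrier K"
      using xy by (auto simp: mem_ideal_transform_iff)
    \<comment> \<open>The product lies in \<open>I\<close> and in \<open>J\<close>, so this single
      member of \<open>S\<close> is carried into \<open>A\<close> by both \<open>x\<close> and
      \<open>y\<close>.\<close>
    let ?P = "ideal_prod (K\<lparr>carrier := D\<rparr>) I J"
    have P: "?P \<in> S" "?P \<subseteq> I" "?P \<subseteq> J"
      using S IJ ideal_of_ideal_prod(2,3)[of I J]
      by (simp_all add: multiplicative_set_of_ideals_def)
    have "(x \<oplus> y) \<otimes> p \<in> A" if "p \<in> ?P" for p
    proof -
      have "x \<otimes> p \<in> A" "y \<otimes> p \<in> A" "p \<in> D"
        using that P IJ S_ideal[OF P(1)] by auto
      then show ?thesis
        using A K by (simp add: l_distr D_submodule_iff)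
    qed
    then show ?thesis
      using P K by (auto simp: mem_ideal_transform_iff)
  qed
  show "d \<otimes> x \<in> ideal_transform K S A"
    if d: "d \<in> D" and x: "x \<in> ideal_transform K S A" for d x
  proof -
    obtain I where I: "I \<in> S" "\<forall>i\<in>I. x \<otimes> i \<in> A" and K: "x \<in> carrier K"
      using x by (auto simp: mem_ideal_transform_iff)
    have "d \<otimes> x \<otimes> i \<in> A" if "i \<in> I" for i
      using that I d K A S_ideal[OF I(1)] by (auto simp: m_assoc D_submodule_iff)
    then show ?thesis
      using I d K by (auto simp: mem_ideal_transform_iff)
  qed
qed

text \<open>Any \<open>I \<in> S\<close> is a witness for \<open>a \<in> A\<close>, since
  \<open>a I \<subseteq> a D \<subseteq> A\<close>; one exists because \<open>S\<close> is
  nonempty.\<close>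

lemma subset_ideal_transform:
  assumes S: "multiplicative_set_of_ideals D K S" and A: "D_submodule A"
  shows "A \<subseteq> ideal_transform K S A"
proof
  fix a assume a: "a \<in> A"
  obtain I where I: "I \<in> S" "I \<subseteq> D"
    using S by (auto simp: multiplicative_set_of_ideals_def ideal_of_iff)
  have "a \<otimes> i \<in> A" if "i \<in> I" for i
    using that a I A m_comm[of a i] by (auto simp: D_submodule_iff subset_iff)
  then show "a \<in> ideal_transform K S A"
    using a I A by (auto simp: mem_ideal_transform_iff D_submodule_iff)
qed

text \<open>As \<open>a\<close> is invertible in \<open>K\<close>,
  \<open>x I \<subseteq> a A\<close> holds iff \<open>(inv a \<otimes> x) I \<subseteq> A\<close>,
  so the same \<open>I\<close> is a witness on both sides.\<close>

lemma ideal_transform_l_coset: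
  assumes a: "a \<in> carrier K - {\<zero>}" and A: "A \<subseteq> carrier K" and S: "\<Union>S \<subseteq> carrier K"
  shows "ideal_transform K S (a <#\<^bsub>K\<^esub> A) = a <#\<^bsub>K\<^esub> ideal_transform K S A"
proof -
  have inv: "inv a \<in> carrier K" "a \<otimes> inv a = \<one>" "inv a \<otimes> a = \<one>"
    using a by (auto simp: field_Units)
  have mult: "y \<in> a <#\<^bsub>K\<^esub> B \<longleftrightarrow> inv a \<otimes> y \<in> B" if "y \<in> carrier K" "B \<subseteq> carrier K" for y B
  proof
    assume "y \<in> a <#\<^bsub>K\<^esub> B"
    then obtain b where b: "b \<in> B" "y = a \<otimes> b"
      by (auto simp: mem_l_coset_iff)
    then have "inv a \<otimes> y = b"
      using a inv that m_assoc[of "inv a" a b] by (auto simp: subset_iff)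
    with b show "inv a \<otimes> y \<in> B"
      by simp
  next
    assume "inv a \<otimes> y \<in> B"
    moreover have "y = a \<otimes> (inv a \<otimes> y)"
      using a inv that m_assoc[of a "inv a" y] by simp
    ultimately show "y \<in> a <#\<^bsub>K\<^esub> B"
      by (auto simp: mem_l_coset_iff)
  qed
  have coset: "a <#\<^bsub>K\<^esub> B \<subseteq> carrier K" if "B \<subseteq> carrier K" for B
    using a that by (auto simp: l_coset_subset_iff)
  have transform: "ideal_transform K S B \<subseteq> carrier K" for B
    by (auto simp: ideal_transform_def)
  have "x \<in> ideal_transform K S (a <#\<^bsub>K\<^esub> A) \<longleftrightarrow> x \<in> a <#\<^bsub>K\<^esub> ideal_transform K S A"
    if x: "x \<in> carrier K" for x
  proof -
    have "x \<otimes> i \<in> a <#\<^bsub>K\<^esub> A \<longleftrightarrow> inv a \<otimes> x \<otimes> i \<in> A" if "I \<in> S" "i \<in> I" for i I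
    proof -
      have "i \<in> carrier K"
        using that S by auto
      then show ?thesis
        using mult[of "x \<otimes> i" A] x A inv by (simp add: m_assoc)
    qed
    then show ?thesis
      using x inv transform by (simp add: mult mem_ideal_transform_iff cong: bex_cong)
  qed
  then show ?thesis
    using coset transform by blast
qed

section \<open>The transform of \<open>D\<close>, inverses and the saturation\<close>

text \<open>If \<open>x I \<subseteq> D\<close>, then \<open>x\<close> is in the inverse of
  \<open>I\<close>. Since \<open>\<one> \<in> D\<close> and \<open>D\<close> is the
  \<open>v\<close>-closure of \<open>I\<close>, multiplication by \<open>\<one>\<close> sends that
  inverse into \<open>D\<close>, so \<open>x \<in> D\<close>.\<close>

lemma ideal_transform_D:
  assumes S: "multiplicative_set_of_ideals D K S" and v: "S \<subseteq> v_dense_ideals D K"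
  shows "ideal_transform K S D = D"
proof
  show "ideal_transform K S D \<subseteq> D"
  proof
    fix x assume "x \<in> ideal_transform K S D"
    then obtain I where I: "I \<in> S" "x \<in> fractional_inverse D K I"
      by (auto simp: ideal_transform_def fractional_inverse_def)
    then have "\<one> \<in> v_closure D K I"
      using v by (auto simp: v_dense_ideals_def)
    with I have "\<one> \<otimes> x \<in> D"
      unfolding v_closure_def by (auto simp: fractional_inverse_def[of _ _ "fractional_inverse D K I"] l_coset_subset_iff)
    then show "x \<in> D"
      using I by (simp add: fractional_inverse_def)
  qed
  show "D \<subseteq> ideal_transform K S D"
    using S ideal_of_D by (intro subset_ideal_transform) (auto simp: ideal_of_iff)
qed

lemma fractional_inverse_D: "fractional_inverse D K D = D"
proof
  show "fractional_inverse D K D \<subseteq> D"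
  proof
    fix x assume "x \<in> fractional_inverse D K D"
    then have "x \<in> carrier K" "x \<otimes> \<one> \<in> D"
      unfolding fractional_inverse_def l_coset_subset_iff using D_closed(3) by blast+
    then show "x \<in> D"
      by simp
  qed
  show "D \<subseteq> fractional_inverse D K D"
    by (auto simp: fractional_inverse_def l_coset_subset_iff)
qed

text \<open>Inverses reverse inclusion: the inverse of \<open>J\<close> lies in that of
  \<open>I\<close>, which lies in the transform of \<open>D\<close> and so in \<open>D\<close>. It
  contains \<open>D\<close> because \<open>J\<close> is an ideal. Hence it equals \<open>D\<close>,
  and inverting once more gives \<open>D\<close> again.\<close>

lemma v_closure_eq_D:
  assumes "ideal_of D K J" "I \<in> S" "I \<subseteq> J" "ideal_transform K S D \<subseteq> D"
  shows "v_closure D K J = D"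
proof -
  have "fractional_inverse D K J = D"
  proof
    show "fractional_inverse D K J \<subseteq> D"
    proof -
      have "fractional_inverse D K J \<subseteq> ideal_transform K S D"
        using assms(2,3) unfolding fractional_inverse_def ideal_transform_def l_coset_subset_iff
        by blast
      with assms(4) show ?thesis
        by blast
    qed
    show "D \<subseteq> fractional_inverse D K J"
      using assms(1) by (auto simp: fractional_inverse_def l_coset_subset_iff ideal_of_iff)
  qed
  then show ?thesis
    by (simp add: v_closure_def fractional_inverse_D)
qed

text \<open>If \<open>I \<subseteq> A\<close> and \<open>J \<subseteq> B\<close> with
  \<open>I\<close> and \<open>J\<close> in \<open>S\<close>, then \<open>I J\<close> is a member of
  \<open>S\<close> inside \<open>A B\<close>.\<close>

lemma multiplicative_saturation:
  assumes S: "multiplicative_set_of_ideals D K S"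
  shows "multiplicative_set_of_ideals D K (saturation D K S)"
  unfolding multiplicative_set_of_ideals_def
proof (intro conjI ballI)
  show "saturation D K S \<noteq> {}"
    using S by (auto simp: multiplicative_set_of_ideals_def saturation_def)
  show "ideal_of D K I" if "I \<in> saturation D K S" for I
    using that by (simp add: saturation_def)
  show "ideal_prod (K\<lparr>carrier := D\<rparr>) A B \<in> saturation D K S"
    if AB: "A \<in> saturation D K S" "B \<in> saturation D K S" for A B
  proof -
    obtain I J where "I \<in> S" "J \<in> S" "I \<subseteq> A" "J \<subseteq> B"
      using AB by (auto simp: saturation_def)
    then have "ideal_prod (K\<lparr>carrier := D\<rparr>) I J \<in> S"
      "ideal_prod (K\<lparr>carrier := D\<rparr>) I J \<subseteq> ideal_prod (K\<lparr>carrier := D\<rparr>) A B"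
      using S by (simp_all add: multiplicative_set_of_ideals_def ideal_prod_mono)
    then show ?thesis
      using AB ideal_of_ideal_prod(1) by (auto simp: saturation_def)
  qed
qed

section \<open>From a localizing GV-system to a star-operation\<close>

text \<open>A common denominator \<open>d\<close> of \<open>A\<close> also serves for its transform:
  by homogeneity and monotonicity, \<open>d A\<^sub>S = (d A)\<^sub>S \<subseteq> D\<^sub>S
  \<subseteq> D\<close>.\<close>

lemma ideal_transform_fractional:
  assumes S: "multiplicative_set_of_ideals D K S"
    and D: "ideal_transform K S D \<subseteq> D"
    and A: "A \<in> nonzero_fractional_ideals D K"
  shows "ideal_transform K S A \<in> nonzero_fractional_ideals D K"
proof -
  obtain d where subm: "D_submodule A" and d: "d \<in> D - {\<zero>}" "d <#\<^bsub>K\<^esub> A \<subseteq> D" and nz: "A \<noteq> {\<zero>}"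
    using A by (auto simp: nonzero_fractional_ideals_def fractional_ideal_def)
  have AK: "A \<subseteq> carrier K" and SK: "\<Union>S \<subseteq> carrier K"
    using subm S by (auto simp: D_submodule_iff multiplicative_set_of_ideals_def ideal_of_iff)
  have "d <#\<^bsub>K\<^esub> ideal_transform K S A = ideal_transform K S (d <#\<^bsub>K\<^esub> A)"
    using d AK SK by (subst ideal_transform_l_coset) auto
  also have "\<dots> \<subseteq> D"
    using ideal_transform_mono[OF d(2)] D by blast
  finally have "d <#\<^bsub>K\<^esub> ideal_transform K S A \<subseteq> D" .
  moreover have "ideal_transform K S A \<noteq> {\<zero>}"
    using subset_ideal_transform[OF S subm] subm nz by (auto simp: D_submodule_iff)
  ultimately show ?thesis
    using d D_submodule_ideal_transform[OF S subm]
    by (auto simp: nonzero_fractional_ideals_def fractional_ideal_def)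
qed

lemma ideal_transform_idem:
  assumes S: "multiplicative_set_of_ideals D K S"
    and loc: "localizing_system D K (saturation D K S)"
    and A: "D_submodule A"
  shows "ideal_transform K S (ideal_transform K S A) = ideal_transform K S A"
proof
  show "ideal_transform K S (ideal_transform K S A) \<subseteq> ideal_transform K S A"
  proof
    fix x assume "x \<in> ideal_transform K S (ideal_transform K S A)"
    then obtain I where x: "x \<in> carrier K" and I: "I \<in> S" "\<forall>i\<in>I. x \<otimes> i \<in> ideal_transform K S A"
      by (auto simp: mem_ideal_transform_iff)
    have I': "I \<in> saturation D K S"
      using I S by (auto simp: saturation_def multiplicative_set_of_ideals_def)
    then have ID: "I \<subseteq> D"
      by (auto simp: saturation_def ideal_of_iff)
    \<comment> \<open>It suffices that this ideal lies in the saturation: it then contains some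
      \<open>L \<in> S\<close>, and \<open>x L \<subseteq> A\<close>.\<close>
    define J where "J = {d \<in> D. x \<otimes> d \<in> A}"
    have J: "ideal_of D K J"
      unfolding J_def using A x by (rule preimage_mult_ideal)
    have "ideal_colon D K J i \<in> saturation D K S" if i: "i \<in> I" for i
    proof -
      obtain L where L: "L \<in> S" "\<forall>l\<in>L. x \<otimes> i \<otimes> l \<in> A"
        using I i by (auto simp: mem_ideal_transform_iff)
      have LD: "L \<subseteq> D"
        using S L by (auto simp: multiplicative_set_of_ideals_def ideal_of_iff)
      have iD: "i \<in> D"
        using i ID by auto
      \<comment> \<open>The colon ideal is a preimage of the same kind, with
        \<open>x \<otimes> i\<close> in place of \<open>x\<close>; hence it is an ideal, and it
        contains the \<open>L\<close> that witnesses
        \<open>x \<otimes> i \<in> A\<^sub>S\<close>.\<close>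
      have colon: "ideal_colon D K J i = {d \<in> D. (x \<otimes> i) \<otimes> d \<in> A}"
        using iD x by (auto simp: ideal_colon_def J_def m_ac)
      have "ideal_of D K (ideal_colon D K J i)"
        unfolding colon using A x iD by (intro preimage_mult_ideal) auto
      moreover have "L \<subseteq> ideal_colon D K J i"
        using L LD by (auto simp: colon)
      ultimately show ?thesis
        using L by (auto simp: saturation_def)
    qed
    then have "J \<in> saturation D K S"
      using loc I' J unfolding localizing_system_def by blast
    then show "x \<in> ideal_transform K S A"
      using x by (auto simp: saturation_def mem_ideal_transform_iff J_def)
  qed
  show "ideal_transform K S A \<subseteq> ideal_transform K S (ideal_transform K S A)"
    using S A by (intro subset_ideal_transform D_submodule_ideal_transform)
qed

lemma star_operation_ideal_transform:
  assumes S: "multiplicative_set_of_ideals D K S"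
    and loc: "localizing_system D K (saturation D K S)"
    and v: "saturation D K S \<subseteq> v_dense_ideals D K"
  shows "star_operation D K (ideal_transform K S)"
proof -
  have SK: "\<Union>S \<subseteq> carrier K" and sat: "S \<subseteq> saturation D K S"
    using S
    by (auto simp: multiplicative_set_of_ideals_def ideal_of_iff D_submodule_iff saturation_def)
  \<comment> \<open>Density is assumed for the saturation and passes to \<open>S\<close>, which is
    contained in it.\<close>
  have D: "ideal_transform K S D = D"
    using S sat v by (intro ideal_transform_D) auto
  have subm: "D_submodule A" "A \<subseteq> carrier K" if "A \<in> nonzero_fractional_ideals D K" for A
    using that by (auto simp: nonzero_fractional_ideals_def fractional_ideal_def D_submodule_iff)
  show ?thesis
    unfolding star_operation_def Let_def
  proof (intro conjI ballI impI)
    show "ideal_transform K S \<in> nonzero_fractional_ideals D K \<rightarrow> nonzero_fractional_ideals D K"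
      using ideal_transform_fractional[OF S] D by auto
    show "ideal_transform K S (a <#\<^bsub>K\<^esub> D) = a <#\<^bsub>K\<^esub> D" if "a \<in> carrier K - {\<zero>}" for a
      using ideal_transform_l_coset[OF that D.subset SK] D by simp
  qed (use SK subm in \<open>simp_all add: ideal_transform_l_coset ideal_transform_idem[OF S loc]
      subset_ideal_transform[OF S] ideal_transform_mono\<close>)
qed

section \<open>From a star-operation to a localizing GV-system\<close>

lemma saturation_v_dense:
  assumes nz: "S \<subseteq> nonzero_ideals D K"
    and D: "ideal_transform K S D \<subseteq> D"
  shows "saturation D K S \<subseteq> v_dense_ideals D K"
proof
  fix J assume "J \<in> saturation D K S"
  then obtain I where I: "I \<in> S" "I \<subseteq> J" and J: "ideal_of D K J"
    by (auto simp: saturation_def)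
  have "ideal_of D K I" "I \<noteq> {\<zero>}"
    using nz I by (auto simp: nonzero_ideals_def)
  then have "J \<noteq> {\<zero>}"
    using I by (auto simp: ideal_of_iff D_submodule_iff)
  then show "J \<in> v_dense_ideals D K"
    using J v_closure_eq_D[OF J I D] by (simp add: v_dense_ideals_def nonzero_ideals_def)
qed

lemma localizing_saturation:
  assumes S: "multiplicative_set_of_ideals D K S"
    and nz: "S \<subseteq> nonzero_ideals D K"
    and idem: "\<And>A. A \<in> nonzero_fractional_ideals D K \<Longrightarrow>
      ideal_transform K S (ideal_transform K S A) \<subseteq> ideal_transform K S A"
  shows "localizing_system D K (saturation D K S)"
  unfolding localizing_system_def
proof (intro conjI ballI allI impI; (elim conjE)?)
  show "saturation D K S \<noteq> {}"
    using multiplicative_saturation[OF S] by (simp add: multiplicative_set_of_ideals_def)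
  show "ideal_of D K I" if "I \<in> saturation D K S" for I
    using that by (simp add: saturation_def)
  show "J \<in> saturation D K S" if "I \<in> saturation D K S" "ideal_of D K J" "I \<subseteq> J" for I J
    using that by (auto simp: saturation_def)
  show "J \<in> saturation D K S"
    if I_sat: "I \<in> saturation D K S" and J: "ideal_of D K J"
      and colon: "\<forall>i\<in>I. ideal_colon D K J i \<in> saturation D K S" for I J
  proof -
    obtain I' where I': "I' \<in> S" "I' \<subseteq> I" and I: "ideal_of D K I"
      using I_sat by (auto simp: saturation_def)
    have ID: "I \<subseteq> D"
      using I by (simp add: ideal_of_iff)
    have nonzero: "\<exists>l\<in>L. l \<noteq> \<zero>" if "L \<in> S" for L
      using nz that by (auto simp: nonzero_ideals_def ideal_of_iff D_submodule_iff)
    \<comment> \<open>This is \<open>I \<subseteq> J\<^sub>S\<close> elementwise; that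
      \<open>L\<close> lies in \<open>D\<close> is recorded for the use of
      \<open>integral_iff\<close> below.\<close>
    have transform: "\<exists>L\<in>S. \<forall>l\<in>L. l \<in> D \<and> i \<otimes> l \<in> J" if i: "i \<in> I" for i
    proof -
      obtain L where L: "L \<in> S" "L \<subseteq> ideal_colon D K J i"
        using colon i by (auto simp: saturation_def)
      moreover have "i \<otimes> l \<in> J \<and> l \<in> D" if "l \<in> L" for l
        using that L i ID m_comm[of i l] by (auto simp: ideal_colon_def subset_iff)
      ultimately show ?thesis
        by auto
    qed
    \<comment> \<open>Idempotence is given for nonzero fractional ideals, so \<open>J\<close> has to
      be shown nonzero first. Members of \<open>S\<close> are nonzero, which yields nonzero factors
      \<open>i\<close> and \<open>l\<close> whose product lies in \<open>J\<close>.\<close>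
    have "J \<noteq> {\<zero>}"
    proof -
      obtain i where i: "i \<in> I" "i \<noteq> \<zero>"
        using nonzero I' by blast
      obtain L where L: "L \<in> S" "\<forall>l\<in>L. l \<in> D \<and> i \<otimes> l \<in> J"
        using transform i by blast
      obtain l where l: "l \<in> L" "l \<noteq> \<zero>"
        using nonzero L by blast
      have "i \<otimes> l \<in> J" "i \<otimes> l \<noteq> \<zero>"
        using i l L ID integral_iff[of i l] by auto
      then show ?thesis
        by auto
    qed
    then have F: "J \<in> nonzero_fractional_ideals D K"
      using J by (simp add: nonzero_ideal_is_fractional)
    have "I \<subseteq> ideal_transform K S J"
      using transform ID by (fastforce simp: mem_ideal_transform_iff)
    \<comment> \<open>The witness is \<open>I'\<close>, because the transform asks for a member of
      \<open>S\<close> itself, whereas \<open>I\<close> is only known to lie in the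
      saturation.\<close>
    then have "\<one> \<in> ideal_transform K S (ideal_transform K S J)"
      using I' ID by (auto simp: mem_ideal_transform_iff[of _ _ _ "ideal_transform K S J"] subset_iff
          intro!: bexI[of _ I'])
    \<comment> \<open>Membership of \<open>\<one>\<close> in the transform of \<open>J\<close> means
      that \<open>J\<close> contains a member of \<open>S\<close>, that is, \<open>J\<close> is in
      the saturation.\<close>
    then have "\<one> \<in> ideal_transform K S J"
      using idem[OF F] by blast
    then obtain L where L: "L \<in> S" "\<forall>l\<in>L. \<one> \<otimes> l \<in> J"
      by (auto simp: mem_ideal_transform_iff)
    have "L \<subseteq> D"
      using S L by (auto simp: multiplicative_set_of_ideals_def ideal_of_iff)
    then have "L \<subseteq> J"
      using L by (auto simp: subset_iff)
    then show ?thesis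
      using L J by (auto simp: saturation_def)
  qed
qed

text \<open>The axiom on principal fractional ideals at \<open>a = \<one>\<close>; it provides the
  input for density of the saturation.\<close>

lemma star_operation_fixes_D:
  assumes "star_operation D K star"
  shows "star D = D"
proof -
  have "\<one> <#\<^bsub>K\<^esub> D = D"
    by (auto simp: l_coset_def)
  moreover have "star (\<one> <#\<^bsub>K\<^esub> D) = \<one> <#\<^bsub>K\<^esub> D"
    using assms by (simp add: star_operation_def Let_def)
  ultimately show ?thesis
    by simp
qed

end

theorem theorem2p12:
  fixes K :: "('a, 'b) ring_scheme" and D :: "'a set" and S :: "'a set set"
  assumes "quotient_field D K"
    and "multiplicative_set_of_ideals D K S"
    and "S \<subseteq> nonzero_ideals D K"
  shows "star_operation D K (\<lambda>A. ideal_transform K S A) \<longleftrightarrow>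
         localizing_system D K (saturation D K S) \<and> GV_system D K (saturation D K S)"
proof
  interpret quotient_field D K by (rule assms(1))
  {
    assume star: "star_operation D K (\<lambda>A. ideal_transform K S A)"
    have "saturation D K S \<subseteq> v_dense_ideals D K"
      using star_operation_fixes_D[OF star] by (intro saturation_v_dense assms) simp
    moreover have "localizing_system D K (saturation D K S)"
      using star by (intro localizing_saturation assms) (simp add: star_operation_def Let_def)
    \<comment> \<open>The multiplicative half of \<open>GV_system\<close> is inherited from
      \<open>S\<close>; the containment in the dense ideals is what the star axioms provide.\<close>
    ultimately show "localizing_system D K (saturation D K S) \<and> GV_system D K (saturation D K S)"
      using multiplicative_saturation[OF assms(2)] by (simp add: GV_system_def)
  }
  {
    assume "localizing_system D K (saturation D K S) \<and> GV_system D K (saturation D K S)"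
    then show "star_operation D K (\<lambda>A. ideal_transform K S A)"
      using star_operation_ideal_transform[OF assms(2)] by (simp add: GV_system_def)
  }
qed

end
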